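(* For any connected graph $G$ of order $n\ge 2$, $$2n+\gamma_t(M(G))\le \gamma_{tc}(M(G\circ P_2))\le 4n.$$
   Context: All graphs are finite, simple and undirected. The $2$-corona $G\circ P_2$ is the graph of order $3|V(G)|$ obtained from $G$ by attaching to each vertex $v$ of $G$ a path of length $2$ (i.e., new vertices $a_v,b_v$ and edges $va_v$, $a_vb_v$), these paths being vertex-disjoint. For a graph $H$, a set $D\subseteq V(H)$ is a total dominating set if every vertex of $H$ has a neighbor in $D$; $\gamma_t(H)$ is the minimum cardinality of a total dominating set of $H$. A set $D\subseteq V(H)$ is a total outer-connected dominating set of $H$ if $D$ is a total dominating set and the induced subgraph $H[V(H)\setminus D]$ is connected; $\gamma_{tc}(H)$ denotes the minimum cardinality of a total outer-connected dominating set of $H$. The middle graph $M(G)$ of a graph $G$ has vertex set $V(G)\cup E(G)$, where two elements $x,y$ are adjacent iff either $x,y\in E(G)$ are edges of $G$ sharing an endpoint, or one of them is a vertex of $G$ and the other is an edge of $G$ incident to it. *)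

theory Defs
  imports "Graph_Theory.Graph_Theory"
begin

text \<open>A finite simple undirected graph is a record satisfying the locale predicate
  \<^const>\<open>pair_graph\<close>: an undirected edge \<open>uv\<close> is the pair of opposite arcs \<open>(u,v)\<close>, \<open>(v,u)\<close>.
  Its undirected edges are recovered as two-element vertex sets.\<close>

definition edges :: "'a pair_pre_digraph \<Rightarrow> 'a set set" where
  "edges G = {{u, v} | u v. (u, v) \<in> parcs G}"

datatype 'a corona_vertex = Orig 'a | Near 'a | Far 'a

text \<open>\<open>Near v\<close> and \<open>Far v\<close> are the vertices \<open>a\<^sub>v\<close> and \<open>b\<^sub>v\<close> of the path attached to \<open>v\<close>.\<close>

definition corona_P2 :: "'a pair_pre_digraph \<Rightarrow> 'a corona_vertex pair_pre_digraph" where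
  "corona_P2 G = \<lparr>
     pverts = Orig ` pverts G \<union> Near ` pverts G \<union> Far ` pverts G,
     parcs = {(Orig u, Orig v) | u v. (u, v) \<in> parcs G}
       \<union> (\<Union>v\<in>pverts G. {(Orig v, Near v), (Near v, Orig v), (Near v, Far v), (Far v, Near v)}) \<rparr>"

definition middle_graph :: "'a pair_pre_digraph \<Rightarrow> ('a + 'a set) pair_pre_digraph" where
  "middle_graph G = \<lparr>
     pverts = Inl ` pverts G \<union> Inr ` edges G,
     parcs = {(Inr e, Inr f) | e f. e \<in> edges G \<and> f \<in> edges G \<and> e \<noteq> f \<and> e \<inter> f \<noteq> {}}
       \<union> {(Inl v, Inr e) | v e. v \<in> pverts G \<and> e \<in> edges G \<and> v \<in> e}
       \<union> {(Inr e, Inl v) | v e. v \<in> pverts G \<and> e \<in> edges G \<and> v \<in> e} \<rparr>"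

definition total_dominating_set :: "'a pair_pre_digraph \<Rightarrow> 'a set \<Rightarrow> bool" where
  "total_dominating_set H D \<longleftrightarrow>
     D \<subseteq> pverts H \<and> (\<forall>v\<in>pverts H. \<exists>u\<in>D. (v, u) \<in> parcs H)"

definition total_domination_number :: "'a pair_pre_digraph \<Rightarrow> nat" where
  "total_domination_number H = (LEAST k. \<exists>D. total_dominating_set H D \<and> card D = k)"

text \<open>\<^const>\<open>Digraph_Component.connected\<close> requires a nonempty vertex set, so the whole vertex set
  is never total outer-connected dominating.\<close>

definition total_outer_connected_dominating_set :: "'a pair_pre_digraph \<Rightarrow> 'a set \<Rightarrow> bool" where
  "total_outer_connected_dominating_set H D \<longleftrightarrow>
     total_dominating_set H D \<and>
     Digraph_Component.connected (with_proj H \<restriction> (pverts H - D))"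

definition total_outer_connected_domination_number :: "'a pair_pre_digraph \<Rightarrow> nat" where
  "total_outer_connected_domination_number H =
     (LEAST k. \<exists>D. total_outer_connected_dominating_set H D \<and> card D = k)"

lemma finite_edges:
  assumes "pair_graph G"
  shows "finite (edges G)"
proof -
  interpret pair_graph G by fact
  have "edges G = (\<lambda>(u, v). {u, v}) ` parcs G"
    by (auto simp: edges_def)
  then show ?thesis
    using pair_finite_arcs by simp
qed

lemma pair_graph_corona_P2:
  assumes "pair_graph G"
  shows "pair_graph (corona_P2 G)"
proof -
  interpret pair_graph G by fact
  have arcs: "{(Orig u, Orig v) | u v. (u, v) \<in> parcs G} = map_prod Orig Orig ` parcs G"
    by force
  show ?thesis
  proof
    show "finite (parcs (corona_P2 G))"
      unfolding corona_P2_def arcs by simp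
    show "symmetric (with_proj (corona_P2 G))"
      unfolding symmetric_def
      by (rule symI) (auto simp: corona_P2_def dest: arcs_symmetric)
  qed (auto simp: corona_P2_def dest: in_arcsD1 in_arcsD2 no_loops')
qed

lemma card_corona_P2:
  assumes "pair_graph G"
  shows "card (pverts (corona_P2 G)) = 3 * card (pverts G)"
proof -
  interpret pair_graph G by fact
  have "card (pverts (corona_P2 G))
      = card (Orig ` pverts G) + card (Near ` pverts G) + card (Far ` pverts G)"
    unfolding corona_P2_def pair_pre_digraph.simps
    by (subst card_Un_disjoint; auto)+
  then show ?thesis
    by (simp add: card_image inj_on_def)
qed

lemma pair_graph_middle_graph:
  assumes "pair_graph G"
  shows "pair_graph (middle_graph G)"
proof -
  interpret pair_graph G by fact
  have fin: "finite (pverts (middle_graph G))"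
    using finite_edges[OF assms] by (simp add: middle_graph_def)
  show ?thesis
  proof
    have "parcs (middle_graph G) \<subseteq> pverts (middle_graph G) \<times> pverts (middle_graph G)"
      by (auto simp: middle_graph_def)
    then show "finite (parcs (middle_graph G))"
      using fin finite_subset by blast
    show "symmetric (with_proj (middle_graph G))"
      unfolding symmetric_def by (rule symI) (auto simp: middle_graph_def)
  qed (use fin in \<open>auto simp: middle_graph_def\<close>)
qed

end

theory Submission
  imports Defs
begin

text \<open>
  Let \<open>D\<close> be total outer-connected dominating in \<open>M(G \<circ> P\<^sub>2)\<close>. The vertex \<open>b\<^sub>v\<close> has \<open>a\<^sub>vb\<^sub>v\<close> as its only
  neighbour, so all edges \<open>a\<^sub>vb\<^sub>v\<close> lie in \<open>D\<close>, and a vertex \<open>b\<^sub>v\<close> outside \<open>D\<close> is isolated in the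
  complement of \<open>D\<close> and hence is the whole complement. So \<open>D\<close> contains either all \<open>b\<^sub>v\<close> or all
  \<open>a\<^sub>v\<close>, which accounts for \<open>2n\<close> elements. Replacing each remaining edge \<open>va\<^sub>v\<close> by its end \<open>v\<close>
  gives a set of vertices and edges of \<open>G\<close> that dominates \<open>M(G)\<close>, totally except for the
  vertices in the set itself; exchanging each such vertex that is not covered by an edge of the set
  for any edge at it, one vertex after the other, makes the set total dominating.

  For the upper bound, the set of all \<open>a\<^sub>v\<close>, \<open>b\<^sub>v\<close>, \<open>va\<^sub>v\<close>, \<open>a\<^sub>vb\<^sub>v\<close> is total dominating, and its
  complement induces a copy of the connected graph \<open>M(G)\<close>.
\<close>

section \<open>Connectedness of symmetric digraphs\<close>

lemma (in sym_digraph) arcs_ends_symcl: "(arcs_ends G)\<^sup>s = arcs_ends G"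
  using sym_arcs by (auto simp: symcl_def symmetric_def dest: symD)

lemma (in sym_digraph) connected_closed_eq:
  assumes conn: "Digraph_Component.connected G" and S: "S \<subseteq> verts G" "S \<noteq> {}"
    and closed: "\<And>u v. u \<in> S \<Longrightarrow> (u, v) \<in> arcs_ends G \<Longrightarrow> v \<in> S"
  shows "S = verts G"
proof
  obtain u where "u \<in> S"
    using S by blast
  show "verts G \<subseteq> S"
  proof
    fix v assume "v \<in> verts G"
    then have "(u, v) \<in> rtrancl_on (verts G) (arcs_ends G)"
      using conn \<open>u \<in> S\<close> S by (auto simp: connected_conv arcs_ends_symcl)
    then show "v \<in> S"
      by (induction rule: rtrancl_on_induct) (use \<open>u \<in> S\<close> closed in auto)
  qed
qed fact

lemma (in sym_digraph) connectedI_closed: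
  assumes "verts G \<noteq> {}"
    and closed_eq: "\<And>S. S \<subseteq> verts G \<Longrightarrow> S \<noteq> {} \<Longrightarrow> (\<And>u v. u \<in> S \<Longrightarrow> (u, v) \<in> arcs_ends G \<Longrightarrow> v \<in> S)
      \<Longrightarrow> S = verts G"
  shows "Digraph_Component.connected G"
proof -
  have "(u, v) \<in> rtrancl_on (verts G) (arcs_ends G)" if "u \<in> verts G" "v \<in> verts G" for u v
  proof -
    let ?S = "{w. (u, w) \<in> rtrancl_on (verts G) (arcs_ends G)}"
    have "?S = verts G"
      by (rule closed_eq)
        (use \<open>u \<in> verts G\<close> in
          \<open>auto dest: in_rtrancl_on_in_F intro: rtrancl_on_into_rtrancl_on adj_in_verts\<close>)
    then show ?thesis
      using \<open>v \<in> verts G\<close> by blast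
  qed
  then show ?thesis
    using assms(1) by (simp add: connected_conv arcs_ends_symcl)
qed

lemma arcs_ends_induce_with_proj:
  "arcs_ends (with_proj G \<restriction> C) = {(u, v) \<in> parcs G. u \<in> C \<and> v \<in> C}"
  by (auto simp: arcs_ends_conv)

lemma (in pair_sym_digraph) sym_digraph_induce: "sym_digraph (with_proj G \<restriction> C)"
  by unfold_locales
    (auto simp: symmetric_def arcs_ends_induce_with_proj intro: symI arcs_symmetric)

lemma connected_induce_image:
  assumes "pair_sym_digraph G" "pair_sym_digraph H"
    and conn: "Digraph_Component.connected (with_proj G)"
    and hom: "\<And>u v. (u, v) \<in> parcs G \<Longrightarrow> (f u, f v) \<in> parcs H"
  shows "Digraph_Component.connected (with_proj H \<restriction> (f ` pverts G))"
proof -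
  interpret G: pair_sym_digraph G by fact
  interpret H: pair_sym_digraph H by fact
  interpret K: sym_digraph "with_proj H \<restriction> (f ` pverts G)"
    by (rule H.sym_digraph_induce)
  show ?thesis
  proof (rule K.connectedI_closed, unfold induce_subgraph_verts arcs_ends_induce_with_proj)
    show "f ` pverts G \<noteq> {}"
      using conn by (simp add: connected_conv)
  next
    fix S assume S: "S \<subseteq> f ` pverts G" "S \<noteq> {}"
      and closed: "\<And>x y. x \<in> S \<Longrightarrow>
        (x, y) \<in> {(x, y) \<in> parcs H. x \<in> f ` pverts G \<and> y \<in> f ` pverts G} \<Longrightarrow> y \<in> S"
    have "{u \<in> pverts G. f u \<in> S} = pverts G"
    proof (rule G.connected_closed_eq[OF conn])
      fix u v assume u: "u \<in> {u \<in> pverts G. f u \<in> S}" and uv: "(u, v) \<in> parcs G"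
      have "v \<in> pverts G"
        using uv by (rule G.in_arcsD2)
      then show "v \<in> {u \<in> pverts G. f u \<in> S}"
        using closed[of "f u" "f v"] hom[OF uv] u by simp
    qed (use S in auto)
    then show "S = f ` pverts G"
      using S by blast
  qed
qed

lemma (in pair_graph) connected_imp_verts_covered:
  assumes conn: "Digraph_Component.connected (with_proj G)" and "card (pverts G) \<ge> 2"
  shows "pverts G \<subseteq> \<Union>(edges G)"
proof
  fix v assume v: "v \<in> pverts G"
  have "pverts G \<noteq> {v}"
    using assms(2) by auto
  then obtain w where "(v, w) \<in> parcs G"
    using connected_closed_eq[OF conn, of "{v}"] v by blast
  then have "{v, w} \<in> edges G"
    by (auto simp: edges_def)
  then show "v \<in> \<Union>(edges G)"
    by blast
qed

section \<open>Total domination\<close>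

lemma total_domination_number_le:
  "total_dominating_set H D \<Longrightarrow> total_domination_number H \<le> card D"
  unfolding total_domination_number_def by (rule Least_le) blast

lemma total_outer_connected_domination_number_le:
  "total_outer_connected_dominating_set H D
    \<Longrightarrow> total_outer_connected_domination_number H \<le> card D"
  unfolding total_outer_connected_domination_number_def by (rule Least_le) blast

lemma total_outer_connected_domination_number_attained:
  assumes "total_outer_connected_dominating_set H D"
  obtains D' where "total_outer_connected_dominating_set H D'"
    "card D' = total_outer_connected_domination_number H"
proof -
  have "\<exists>D'. total_outer_connected_dominating_set H D'
      \<and> card D' = total_outer_connected_domination_number H"
    unfolding total_outer_connected_domination_number_def
    by (rule LeastI_ex) (use assms in blast)
  then show thesis
    using that by blast
qed

lemma (in pair_sym_digraph) total_outer_connected_isolated_outside: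
  assumes D: "total_outer_connected_dominating_set G D"
    and x: "x \<in> pverts G - D" and isolated: "\<And>y. (x, y) \<in> parcs G \<Longrightarrow> y \<in> D"
  shows "pverts G - D = {x}"
proof -
  interpret K: sym_digraph "with_proj G \<restriction> (pverts G - D)"
    by (rule sym_digraph_induce)
  have "{x} = verts (with_proj G \<restriction> (pverts G - D))"
    by (rule K.connected_closed_eq)
      (use D x isolated in
        \<open>auto simp: total_outer_connected_dominating_set_def arcs_ends_induce_with_proj\<close>)
  then show ?thesis
    by simp
qed

section \<open>Middle graphs\<close>

lemma ball_Plus: "(\<forall>z\<in>A <+> B. P z) \<longleftrightarrow> (\<forall>a\<in>A. P (Inl a)) \<and> (\<forall>b\<in>B. P (Inr b))"
  by auto

lemma bex_Plus: "(\<exists>z\<in>A <+> B. P z) \<longleftrightarrow> (\<exists>a\<in>A. P (Inl a)) \<or> (\<exists>b\<in>B. P (Inr b))"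
  by blast

lemma Plus_vimage: "Inl -` D <+> Inr -` D = D"
proof (rule set_eqI)
  show "z \<in> Inl -` D <+> Inr -` D \<longleftrightarrow> z \<in> D" for z
    by (cases z) auto
qed

lemma pverts_middle_graph: "pverts (middle_graph G) = pverts G <+> edges G"
  by (auto simp: middle_graph_def)

lemma parcs_middle_graph [simp]:
  "(Inr e, Inr f) \<in> parcs (middle_graph G) \<longleftrightarrow> e \<in> edges G \<and> f \<in> edges G \<and> e \<noteq> f \<and> e \<inter> f \<noteq> {}"
  "(Inl v, Inr e) \<in> parcs (middle_graph G) \<longleftrightarrow> v \<in> pverts G \<and> e \<in> edges G \<and> v \<in> e"
  "(Inr e, Inl v) \<in> parcs (middle_graph G) \<longleftrightarrow> v \<in> pverts G \<and> e \<in> edges G \<and> v \<in> e"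
  "(Inl u, Inl v) \<notin> parcs (middle_graph G)"
  by (auto simp: middle_graph_def)

lemma (in pair_graph) edgesE:
  assumes "e \<in> edges G" "v \<in> e"
  obtains w where "e = {v, w}" "v \<noteq> w" "v \<in> pverts G" "w \<in> pverts G"
  using assms by (auto simp: edges_def dest: in_arcsD1 in_arcsD2 no_loops')

lemma (in pair_wf_digraph) edge_subset_pverts: "e \<in> edges G \<Longrightarrow> e \<subseteq> pverts G"
  by (auto simp: edges_def dest: in_arcsD1 in_arcsD2)

lemma (in pair_wf_digraph) edge_has_vertex:
  assumes "e \<in> edges G"
  obtains v where "v \<in> e" "v \<in> pverts G"
  using assms by (auto simp: edges_def dest: in_arcsD1 in_arcsD2)

lemma connected_middle_graph:
  assumes "pair_graph G" and conn: "Digraph_Component.connected (with_proj G)"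
  shows "Digraph_Component.connected (with_proj (middle_graph G))"
proof -
  interpret pair_graph G by fact
  interpret M: pair_graph "middle_graph G"
    by (rule pair_graph_middle_graph) fact
  show ?thesis
  proof (rule M.connectedI_closed)
    show "pverts (middle_graph G) \<noteq> {}"
      using conn by (simp add: pverts_middle_graph connected_conv)
  next
    fix S assume S: "S \<subseteq> pverts (middle_graph G)" "S \<noteq> {}"
      and closed: "\<And>x y. x \<in> S \<Longrightarrow> (x, y) \<in> parcs (middle_graph G) \<Longrightarrow> y \<in> S"
    obtain W A where S_eq: "S = W <+> A"
      using Plus_vimage by metis
    have WA: "W \<subseteq> pverts G" "A \<subseteq> edges G"
      using S(1) by (auto simp: S_eq pverts_middle_graph)
    have incident: "v \<in> W \<longleftrightarrow> e \<in> A" if "e \<in> edges G" "v \<in> e" for v e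
      using closed[of "Inl v" "Inr e"] closed[of "Inr e" "Inl v"] that edge_subset_pverts
      by (auto simp: S_eq)
    have "W = pverts G"
    proof (rule connected_closed_eq[OF conn WA(1)])
      show "W \<noteq> {}"
      proof
        assume "W = {}"
        then have "A \<noteq> {}"
          using S(2) by (simp add: S_eq)
        then obtain e where e: "e \<in> A" "e \<in> edges G"
          using WA(2) by blast
        obtain v where "v \<in> e"
          using e(2) by (rule edge_has_vertex)
        then show False using incident e \<open>W = {}\<close> by blast
      qed
    next
      fix u v assume "u \<in> W" "(u, v) \<in> parcs G"
      then show "v \<in> W"
        using incident[of "{u, v}"] by (auto simp: edges_def)
    qed
    moreover have "e \<in> A" if "e \<in> edges G" for e
      using edge_has_vertex[OF that] incident[OF that] \<open>W = pverts G\<close> by metis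
    ultimately show "S = pverts (middle_graph G)"
      using WA(2) by (auto simp: S_eq pverts_middle_graph)
  qed
qed

definition totally_dominates_edges :: "'a pair_pre_digraph \<Rightarrow> 'a set \<Rightarrow> 'a set set \<Rightarrow> bool" where
  "totally_dominates_edges G X A \<longleftrightarrow>
     (\<forall>e\<in>edges G. e \<inter> X \<noteq> {} \<or> (\<exists>f\<in>A. f \<noteq> e \<and> f \<inter> e \<noteq> {}))"

lemma total_dominating_set_middle_graph_iff:
  "total_dominating_set (middle_graph G) (X <+> A) \<longleftrightarrow>
     X \<subseteq> pverts G \<and> A \<subseteq> edges G \<and> pverts G \<subseteq> \<Union>A \<and> totally_dominates_edges G X A"
proof -
  have vertex: "(\<exists>y\<in>X <+> A. (Inl v, y) \<in> parcs (middle_graph G)) \<longleftrightarrow> v \<in> \<Union>A"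
    if "A \<subseteq> edges G" "v \<in> pverts G" for v
    using that by (auto simp: bex_Plus)
  have edge: "(\<exists>y\<in>X <+> A. (Inr e, y) \<in> parcs (middle_graph G))
      \<longleftrightarrow> e \<inter> X \<noteq> {} \<or> (\<exists>f\<in>A. f \<noteq> e \<and> f \<inter> e \<noteq> {})"
    if "X \<subseteq> pverts G" "A \<subseteq> edges G" "e \<in> edges G" for e
    unfolding bex_Plus parcs_middle_graph using that by blast
  have "(\<forall>x\<in>pverts (middle_graph G). \<exists>y\<in>X <+> A. (x, y) \<in> parcs (middle_graph G))
      \<longleftrightarrow> pverts G \<subseteq> \<Union>A \<and> totally_dominates_edges G X A"
    if "X \<subseteq> pverts G" "A \<subseteq> edges G"
    by (simp add: pverts_middle_graph ball_Plus vertex edge that totally_dominates_edges_def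
        subset_eq[of "pverts G"] cong: ball_cong)
  moreover have "X <+> A \<subseteq> pverts (middle_graph G) \<longleftrightarrow> X \<subseteq> pverts G \<and> A \<subseteq> edges G"
    by (auto simp: pverts_middle_graph)
  ultimately show ?thesis
    unfolding total_dominating_set_def by meson
qed

lemma (in pair_graph) totally_dominates_edges_exchange:
  assumes dom: "totally_dominates_edges G X A" and cover: "pverts G \<subseteq> X \<union> \<Union>A"
    and e: "e \<in> edges G" "v \<in> e" and v: "v \<notin> \<Union>A"
  shows "totally_dominates_edges G (X - {v}) (insert e A)"
  unfolding totally_dominates_edges_def
proof
  fix g assume g: "g \<in> edges G"
  consider (new) "g = e" | (adjacent) "g \<noteq> e" "v \<in> g" | (away) "v \<notin> g"
    by blast
  then show "g \<inter> (X - {v}) \<noteq> {} \<or> (\<exists>f\<in>insert e A. f \<noteq> g \<and> f \<inter> g \<noteq> {})"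
  proof cases
    case new
    obtain w where w: "e = {v, w}" "v \<noteq> w" "w \<in> pverts G"
      using e by (rule edgesE)
    then have "w \<in> X - {v} \<or> (\<exists>f\<in>A. w \<in> f)"
      using cover by blast
    then show ?thesis
      using new w v by blast
  next
    case adjacent
    then show ?thesis using e by blast
  next
    case away
    then have "g \<inter> (X - {v}) = g \<inter> X" by blast
    then show ?thesis
      using dom g by (auto simp: totally_dominates_edges_def)
  qed
qed

lemma (in pair_graph) total_domination_number_middle_graph_le:
  assumes covered: "pverts G \<subseteq> \<Union>(edges G)"
    and "X \<subseteq> pverts G" "A \<subseteq> edges G" "pverts G \<subseteq> X \<union> \<Union>A" "totally_dominates_edges G X A"
  shows "total_domination_number (middle_graph G) \<le> card X + card A"
  using assms(2-)
proof (induction "card (pverts G - \<Union>A)" arbitrary: X A rule: less_induct)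
  case less
  have fin: "finite X" "finite A"
    using less.prems finite_edges[OF pair_graph] pair_finite_verts by (auto intro: finite_subset)
  show ?case
  proof (cases "pverts G \<subseteq> \<Union>A")
    case True
    then have "total_dominating_set (middle_graph G) (X <+> A)"
      using less.prems by (simp add: total_dominating_set_middle_graph_iff)
    then show ?thesis
      using total_domination_number_le fin by (metis card_Plus)
  next
    case False
    then obtain v where v: "v \<in> pverts G" "v \<notin> \<Union>A" by blast
    obtain e where e: "e \<in> edges G" "v \<in> e"
      using covered v by blast
    have "v \<in> X"
      using less.prems v by blast
    have "pverts G - \<Union>(insert e A) \<subset> pverts G - \<Union>A"
      using v e by blast
    then have "card (pverts G - \<Union>(insert e A)) < card (pverts G - \<Union>A)"
      by (intro psubset_card_mono) auto
    moreover have "totally_dominates_edges G (X - {v}) (insert e A)"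
      using less.prems e v by (intro totally_dominates_edges_exchange)
    ultimately have "total_domination_number (middle_graph G) \<le> card (X - {v}) + card (insert e A)"
      using less.prems e by (intro less.hyps) auto
    also have "\<dots> \<le> card X + card A"
      using \<open>v \<in> X\<close> fin card_Suc_Diff1[of X v] by (simp add: card_insert_if)
    finally show ?thesis .
  qed
qed

section \<open>The 2-corona\<close>

abbreviation spoke :: "'a \<Rightarrow> 'a corona_vertex set" where
  "spoke v \<equiv> {Orig v, Near v}"

abbreviation leaf :: "'a \<Rightarrow> 'a corona_vertex set" where
  "leaf v \<equiv> {Near v, Far v}"

lemma pverts_corona_P2:
  "pverts (corona_P2 G) = Orig ` pverts G \<union> Near ` pverts G \<union> Far ` pverts G"
  by (simp add: corona_P2_def)

lemma edges_corona_P2: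
  "edges (corona_P2 G) = (`) Orig ` edges G \<union> spoke ` pverts G \<union> leaf ` pverts G"
proof -
  have edges_conv_image: "edges H = (\<lambda>(x, y). {x, y}) ` parcs H" for H :: "'b pair_pre_digraph"
    by (auto simp: edges_def)
  have "parcs (corona_P2 G) = map_prod Orig Orig ` parcs G
      \<union> (\<lambda>v. (Orig v, Near v)) ` pverts G \<union> (\<lambda>v. (Near v, Orig v)) ` pverts G
      \<union> (\<lambda>v. (Near v, Far v)) ` pverts G \<union> (\<lambda>v. (Far v, Near v)) ` pverts G"
    by (force simp: corona_P2_def)
  then show ?thesis
    unfolding edges_conv_image by (auto simp: image_Un image_image case_prod_beta insert_commute)
qed

lemma inj_on_corona_edges: "inj_on ((`) Orig) A" "inj_on spoke S" "inj_on leaf L"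
  by (auto simp: inj_on_def inj_def inj_image_eq_iff doubleton_eq_iff)

lemma in_edges_corona_P2:
  "Orig ` e \<in> edges (corona_P2 G) \<longleftrightarrow> e \<in> edges G"
  "spoke v \<in> edges (corona_P2 G) \<longleftrightarrow> v \<in> pverts G"
proof -
  have "Orig ` e \<notin> spoke ` pverts G \<union> leaf ` pverts G"
    by auto
  then show "Orig ` e \<in> edges (corona_P2 G) \<longleftrightarrow> e \<in> edges G"
    by (simp add: edges_corona_P2 inj_image_mem_iff inj_on_corona_edges)
  have "spoke v \<notin> (`) Orig ` edges G \<union> leaf ` pverts G"
    by auto
  then show "spoke v \<in> edges (corona_P2 G) \<longleftrightarrow> v \<in> pverts G"
    using inj_image_mem_iff[OF inj_on_corona_edges(2), of v "pverts G"]
    unfolding edges_corona_P2 by blast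
qed

lemma edge_corona_at_Orig:
  assumes "b \<in> edges (corona_P2 G)" "Orig v \<in> b"
  shows "b = spoke v \<or> (\<exists>e\<in>edges G. v \<in> e \<and> b = Orig ` e)"
  using assms by (auto simp: edges_corona_P2)

lemma card_corona_vertices:
  assumes "finite U" "finite N" "finite F"
  shows "card (Orig ` U \<union> Near ` N \<union> Far ` F) = card U + card N + card F"
  using assms by (subst card_Un_disjoint; auto simp: card_image inj_on_def)+

lemma card_corona_edges:
  assumes "finite A" "finite S" "finite L"
  shows "card ((`) Orig ` A \<union> spoke ` S \<union> leaf ` L) = card A + card S + card L"
proof -
  have "(`) Orig ` A \<inter> spoke ` S = {}" "((`) Orig ` A \<union> spoke ` S) \<inter> leaf ` L = {}"
    by auto
  then show ?thesis
    using assms by (simp add: card_Un_disjoint card_image inj_on_corona_edges)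
qed

section \<open>The lower bound\<close>

lemma leaves_in_total_dominating_set:
  assumes "total_dominating_set (middle_graph (corona_P2 G)) (W <+> B)"
  shows "leaf ` pverts G \<subseteq> B"
proof clarify
  fix v assume "v \<in> pverts G"
  then have "Far v \<in> \<Union>B" "B \<subseteq> edges (corona_P2 G)"
    using assms unfolding total_dominating_set_middle_graph_iff
    by (auto simp: pverts_corona_P2)
  then show "leaf v \<in> B"
    by (force simp: edges_corona_P2)
qed

lemma totally_dominates_edges_of_corona:
  assumes B: "B \<subseteq> edges (corona_P2 G)" and dom: "totally_dominates_edges (corona_P2 G) W B"
  shows "totally_dominates_edges G (Orig -` W \<union> spoke -` B) ((`) Orig -` B)"
  unfolding totally_dominates_edges_def
proof
  fix e assume "e \<in> edges G"
  then have "Orig ` e \<inter> W \<noteq> {} \<or> (\<exists>b\<in>B. b \<noteq> Orig ` e \<and> b \<inter> Orig ` e \<noteq> {})"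
    using dom by (simp add: totally_dominates_edges_def edges_corona_P2)
  then consider (vertex) v where "v \<in> e" "Orig v \<in> W"
    | (edge) b v where "b \<in> B" "b \<noteq> Orig ` e" "v \<in> e" "Orig v \<in> b"
    by blast
  then show "e \<inter> (Orig -` W \<union> spoke -` B) \<noteq> {} \<or> (\<exists>f\<in>(`) Orig -` B. f \<noteq> e \<and> f \<inter> e \<noteq> {})"
  proof cases
    case vertex
    then show ?thesis by blast
  next
    case edge
    then consider (spoke) "b = spoke v" | (orig) f where "v \<in> f" "b = Orig ` f"
      using edge_corona_at_Orig[OF subsetD[OF B edge(1)] edge(4)] by blast
    then show ?thesis
    proof cases
      case spoke
      then show ?thesis using edge by blast
    next
      case orig
      then have "f \<in> (`) Orig -` B" "f \<noteq> e" "f \<inter> e \<noteq> {}"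
        using edge by auto
      then show ?thesis by blast
    qed
  qed
qed

context pair_graph
begin

interpretation middle_corona: pair_graph "middle_graph (corona_P2 G)"
  by (intro pair_graph_middle_graph pair_graph_corona_P2) (rule pair_graph)

lemma total_outer_connected_Far_or_Near:
  assumes D: "total_outer_connected_dominating_set (middle_graph (corona_P2 G)) (W <+> B)"
  shows "Far ` pverts G \<subseteq> W \<or> Near ` pverts G \<subseteq> W"
proof (cases "Far ` pverts G \<subseteq> W")
  case False
  let ?M = "middle_graph (corona_P2 G)"
  obtain v where v: "v \<in> pverts G" "Far v \<notin> W"
    using False by blast
  have "total_dominating_set ?M (W <+> B)"
    using D by (simp add: total_outer_connected_dominating_set_def)
  then have "leaf v \<in> B"
    using leaves_in_total_dominating_set v(1) by blast
  moreover have "y = Inr (leaf v)" if "(Inl (Far v), y) \<in> parcs ?M" for y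
    using that by (cases y) (auto simp: edges_corona_P2)
  ultimately have "pverts ?M - (W <+> B) = {Inl (Far v)}"
    using v by (intro middle_corona.total_outer_connected_isolated_outside[OF D])
      (auto simp: pverts_middle_graph pverts_corona_P2)
  moreover have "Inl (Near w) \<in> pverts ?M" if "w \<in> pverts G" for w
    using that by (auto simp: pverts_middle_graph pverts_corona_P2)
  ultimately show ?thesis
    by blast
qed simp

lemma total_domination_number_middle_graph_le_corona:
  assumes covered: "pverts G \<subseteq> \<Union>(edges G)"
    and D: "total_dominating_set (middle_graph (corona_P2 G)) (W <+> B)"
  shows "total_domination_number (middle_graph G)
    \<le> card (Orig -` W) + card (spoke -` B) + card ((`) Orig -` B)"
proof -
  have W: "W \<subseteq> pverts (corona_P2 G)" and B: "B \<subseteq> edges (corona_P2 G)"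
    and corona_covered: "pverts (corona_P2 G) \<subseteq> \<Union>B"
    and dom: "totally_dominates_edges (corona_P2 G) W B"
    using D unfolding total_dominating_set_middle_graph_iff by auto
  have G_covered: "pverts G \<subseteq> (Orig -` W \<union> spoke -` B) \<union> \<Union>((`) Orig -` B)"
  proof
    fix v assume "v \<in> pverts G"
    then have "Orig v \<in> \<Union>B"
      using corona_covered by (auto simp: pverts_corona_P2)
    then obtain b where b: "b \<in> B" "Orig v \<in> b"
      by blast
    then show "v \<in> (Orig -` W \<union> spoke -` B) \<union> \<Union>((`) Orig -` B)"
      using edge_corona_at_Orig[OF subsetD[OF B b(1)] b(2)] by auto
  qed
  have subsets: "Orig -` W \<union> spoke -` B \<subseteq> pverts G" "(`) Orig -` B \<subseteq> edges G"
    using W by (auto simp: pverts_corona_P2 in_edges_corona_P2 dest!: subsetD[OF B])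
  have "total_domination_number (middle_graph G)
      \<le> card (Orig -` W \<union> spoke -` B) + card ((`) Orig -` B)"
    using covered subsets G_covered totally_dominates_edges_of_corona[OF B dom]
    by (rule total_domination_number_middle_graph_le)
  then show ?thesis
    using card_Un_le[of "Orig -` W" "spoke -` B"] by simp
qed

lemma card_vertices_of_total_outer_connected_ge:
  assumes "finite W" "total_outer_connected_dominating_set (middle_graph (corona_P2 G)) (W <+> B)"
  shows "card (pverts G) + card (Orig -` W) \<le> card W"
proof -
  have fin: "finite (Orig -` W)"
    using assms(1) by (simp add: finite_vimageI inj_def)
  consider (far) "Far ` pverts G \<subseteq> W" | (near) "Near ` pverts G \<subseteq> W"
    using total_outer_connected_Far_or_Near[OF assms(2)] by blast
  then show ?thesis
  proof cases
    case far
    then have "card (Orig ` (Orig -` W) \<union> Near ` {} \<union> Far ` pverts G) \<le> card W"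
      using assms(1) by (intro card_mono) auto
    then show ?thesis
      using card_corona_vertices[OF fin finite.emptyI pair_finite_verts] by simp
  next
    case near
    then have "card (Orig ` (Orig -` W) \<union> Near ` pverts G \<union> Far ` {}) \<le> card W"
      using assms(1) by (intro card_mono) auto
    then show ?thesis
      using card_corona_vertices[OF fin pair_finite_verts finite.emptyI] by simp
  qed
qed

lemma card_edges_of_total_dominating_set_ge:
  assumes "finite B" "total_dominating_set (middle_graph (corona_P2 G)) (W <+> B)"
  shows "card (pverts G) + card (spoke -` B) + card ((`) Orig -` B) \<le> card B"
proof -
  have fin: "finite ((`) Orig -` B)" "finite (spoke -` B)"
    by (rule finite_vimageI[OF assms(1) inj_on_corona_edges(1)])
      (rule finite_vimageI[OF assms(1) inj_on_corona_edges(2)])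
  have "card ((`) Orig -` B) + card (spoke -` B) + card (pverts G)
      = card ((`) Orig ` ((`) Orig -` B) \<union> spoke ` (spoke -` B) \<union> leaf ` pverts G)"
    using card_corona_edges[OF fin pair_finite_verts] by (rule sym)
  also have "\<dots> \<le> card B"
    using leaves_in_total_dominating_set[OF assms(2)] assms(1) by (intro card_mono) auto
  finally show ?thesis by simp
qed

lemma card_total_outer_connected_middle_corona_ge:
  assumes covered: "pverts G \<subseteq> \<Union>(edges G)"
    and D: "total_outer_connected_dominating_set (middle_graph (corona_P2 G)) D"
  shows "2 * card (pverts G) + total_domination_number (middle_graph G) \<le> card D"
proof -
  obtain W B where D_eq: "D = W <+> B"
    using Plus_vimage by metis
  have tds: "total_dominating_set (middle_graph (corona_P2 G)) (W <+> B)"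
    using D by (simp add: total_outer_connected_dominating_set_def D_eq)
  then have "finite (W <+> B)"
    using middle_corona.pair_finite_verts finite_subset unfolding total_dominating_set_def by blast
  then have fin: "finite W" "finite B"
    by simp_all
  have "card D = card W + card B"
    using fin by (simp add: D_eq card_Plus)
  then show ?thesis
    using card_vertices_of_total_outer_connected_ge[OF fin(1) D[unfolded D_eq]]
      card_edges_of_total_dominating_set_ge[OF fin(2) tds]
      total_domination_number_middle_graph_le_corona[OF covered tds]
    by linarith
qed

end

section \<open>The upper bound\<close>

definition attached_paths ::
  "'a pair_pre_digraph \<Rightarrow> ('a corona_vertex + 'a corona_vertex set) set" where
  "attached_paths G =
     (Near ` pverts G \<union> Far ` pverts G) <+> (spoke ` pverts G \<union> leaf ` pverts G)"

lemma (in pair_fin_digraph) card_attached_paths: "card (attached_paths G) = 4 * card (pverts G)"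
  using pair_finite_verts card_corona_vertices[of "{}" "pverts G" "pverts G"]
    card_corona_edges[of "{}" "pverts G" "pverts G"]
  by (simp add: attached_paths_def card_Plus)

lemma outside_attached_paths:
  "pverts (middle_graph (corona_P2 G)) - attached_paths G
    = map_sum Orig ((`) Orig) ` pverts (middle_graph G)"
proof -
  have "(\<lambda>e. Inr (Orig ` e)) ` edges G \<inter> attached_paths G = {}"
    by (auto simp: attached_paths_def)
  then show ?thesis
    by (auto simp: attached_paths_def pverts_middle_graph pverts_corona_P2 edges_corona_P2
        Plus_def image_Un image_image)
qed

lemma (in pair_wf_digraph) total_dominating_set_attached_paths:
  "total_dominating_set (middle_graph (corona_P2 G)) (attached_paths G)"
proof -
  have "totally_dominates_edges (corona_P2 G)
      (Near ` pverts G \<union> Far ` pverts G) (spoke ` pverts G \<union> leaf ` pverts G)"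
    unfolding totally_dominates_edges_def
  proof
    fix e assume "e \<in> edges (corona_P2 G)"
    then consider (orig) f where "f \<in> edges G" "e = Orig ` f"
      | (path) v where "v \<in> pverts G" "Near v \<in> e"
      by (auto simp: edges_corona_P2)
    then show "e \<inter> (Near ` pverts G \<union> Far ` pverts G) \<noteq> {}
      \<or> (\<exists>f\<in>spoke ` pverts G \<union> leaf ` pverts G. f \<noteq> e \<and> f \<inter> e \<noteq> {})"
    proof cases
      case orig
      then obtain v where "v \<in> f" "v \<in> pverts G"
        using edge_has_vertex by blast
      then have "spoke v \<in> spoke ` pverts G" "spoke v \<noteq> e" "spoke v \<inter> e \<noteq> {}"
        using orig by auto
      then show ?thesis by blast
    qed blast
  qed
  then show ?thesis
    unfolding attached_paths_def total_dominating_set_middle_graph_iff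
    by (auto simp: pverts_corona_P2 edges_corona_P2)
qed

lemma (in pair_graph) total_outer_connected_attached_paths:
  assumes "Digraph_Component.connected (with_proj G)"
  shows "total_outer_connected_dominating_set (middle_graph (corona_P2 G)) (attached_paths G)"
proof -
  interpret middle: pair_graph "middle_graph G"
    by (rule pair_graph_middle_graph) (rule pair_graph)
  interpret middle_corona: pair_graph "middle_graph (corona_P2 G)"
    by (intro pair_graph_middle_graph pair_graph_corona_P2) (rule pair_graph)
  let ?f = "map_sum Orig ((`) Orig)"
  have hom: "(?f x, ?f y) \<in> parcs (middle_graph (corona_P2 G))"
    if "(x, y) \<in> parcs (middle_graph G)" for x y
    using that
    by (cases x; cases y) (auto simp: pverts_corona_P2 edges_corona_P2 inj_image_eq_iff inj_def)
  have "Digraph_Component.connected (with_proj (middle_graph (corona_P2 G))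
      \<restriction> (?f ` pverts (middle_graph G)))"
    using connected_middle_graph[OF pair_graph assms] hom
    by (intro connected_induce_image) unfold_locales
  then show ?thesis
    using total_dominating_set_attached_paths
    by (simp add: total_outer_connected_dominating_set_def outside_attached_paths)
qed

theorem theorem4p3:
  fixes G :: "'a pair_pre_digraph" and n :: nat
  assumes "pair_graph G"
    and "Digraph_Component.connected (with_proj G)"
    and "card (pverts G) = n"
    and "n \<ge> 2"
  shows "2 * n + total_domination_number (middle_graph G)
           \<le> total_outer_connected_domination_number (middle_graph (corona_P2 G))
       \<and> total_outer_connected_domination_number (middle_graph (corona_P2 G)) \<le> 4 * n"
proof
  interpret pair_graph G by fact
  have paths: "total_outer_connected_dominating_set (middle_graph (corona_P2 G)) (attached_paths G)"
    using assms(2) by (rule total_outer_connected_attached_paths)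
  then show "total_outer_connected_domination_number (middle_graph (corona_P2 G)) \<le> 4 * n"
    using total_outer_connected_domination_number_le card_attached_paths assms(3) by metis
  obtain D where "total_outer_connected_dominating_set (middle_graph (corona_P2 G)) D"
    "card D = total_outer_connected_domination_number (middle_graph (corona_P2 G))"
    using paths by (rule total_outer_connected_domination_number_attained)
  moreover have "pverts G \<subseteq> \<Union>(edges G)"
    using connected_imp_verts_covered assms(2-4) by simp
  ultimately show "2 * n + total_domination_number (middle_graph G)
      \<le> total_outer_connected_domination_number (middle_graph (corona_P2 G))"
    using card_total_outer_connected_middle_corona_ge assms(3) by metis
qed

end
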